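(* Let $\Psi=(E,\Delta)$ be an ordered simplicial complex in both QE and QC. Then the lexicographic order of the bases of $\mathrm{nbc}(\Psi)$ is a shelling order of $\mathrm{nbc}(\Psi)$.
   Context: An ordered simplicial complex is a pair $\Psi=(E,\Delta)$ with $E$ a finite totally ordered set and $\Delta\subseteq 2^E$ a simplicial complex (closed under taking subsets, $\emptyset\in\Delta$). Elements of $\Delta$ are independent sets; inclusion-maximal ones are bases; inclusion-minimal subsets of $E$ not in $\Delta$ are circuits. $\Psi$ is pure if all bases have the same cardinality. The lexicographic order on subsets of $E$ is the dictionary order on increasingly sorted lists. QE: the class of $\Psi$ that are pure and such that for all bases $B_1,B_2$ and $b_1\in B_1\setminus B_2$ with $b_1>\max(B_2\setminus B_1)$, there is $b_2\in B_2\setminus B_1$ with $(B_1\setminus\{b_1\})\cup\{b_2\}\in\Delta$. QC: the class of $\Psi$ such that if $C_1\neq C_2$ are circuits and $c\in C_1\cap C_2$ satisfies $c<\max (C_1\triangle C_2)$, then there is a circuit $C_3\subseteq (C_1\cup C_2)\setminus\{c\}$. A broken circuit of $\Psi$ is a set $C\setminus\{c\}$ where $C$ is a circuit and $c$ is the smallest element of $C$. $\mathrm{nbc}(\Psi)$ is the complex on $E$ whose bases are the bases of $\Psi$ containing no broken circuit (void if there are none). A shelling order of a pure complex is an ordering $B_1,\dots,B_k$ of its bases such that for every $i<j$ there are $l<j$ and $b\in B_j$ with $B_i\cap B_j\subseteq B_l\cap B_j=B_j\setminus\{b\}$. *)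

theory Defs
  imports "HOL-Library.List_Lexorder"
begin

definition ordered_simplicial_complex :: "'a::linorder set \<Rightarrow> 'a set set \<Rightarrow> bool" where
  "ordered_simplicial_complex E \<Delta> \<longleftrightarrow>
     finite E \<and> \<Delta> \<subseteq> Pow E \<and> {} \<in> \<Delta> \<and> (\<forall>A\<in>\<Delta>. \<forall>B. B \<subseteq> A \<longrightarrow> B \<in> \<Delta>)"

definition bases :: "'a set set \<Rightarrow> 'a set set" where
  "bases \<Delta> = {B \<in> \<Delta>. \<forall>A\<in>\<Delta>. B \<subseteq> A \<longrightarrow> A = B}"

definition circuits :: "'a set \<Rightarrow> 'a set set \<Rightarrow> 'a set set" where
  "circuits E \<Delta> = {C. C \<subseteq> E \<and> C \<notin> \<Delta> \<and> (\<forall>D. D \<subset> C \<longrightarrow> D \<in> \<Delta>)}"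

definition pure :: "'a set set \<Rightarrow> bool" where
  "pure \<Delta> \<longleftrightarrow> (\<forall>A\<in>bases \<Delta>. \<forall>B\<in>bases \<Delta>. card A = card B)"

text \<open>Purity makes \<open>B2 - B1\<close> nonempty below, so its maximum is meaningful; likewise
  the symmetric difference of two distinct circuits in \<open>QC\<close>, and every circuit in
  \<open>broken_circuits\<close>, since the empty set is independent.\<close>

definition QE :: "'a::linorder set set \<Rightarrow> bool" where
  "QE \<Delta> \<longleftrightarrow> pure \<Delta> \<and>
     (\<forall>B1\<in>bases \<Delta>. \<forall>B2\<in>bases \<Delta>. \<forall>b1\<in>B1 - B2. b1 > Max (B2 - B1) \<longrightarrow>
        (\<exists>b2\<in>B2 - B1. (B1 - {b1}) \<union> {b2} \<in> \<Delta>))"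

definition QC :: "'a::linorder set \<Rightarrow> 'a set set \<Rightarrow> bool" where
  "QC E \<Delta> \<longleftrightarrow>
     (\<forall>C1\<in>circuits E \<Delta>. \<forall>C2\<in>circuits E \<Delta>. \<forall>c\<in>C1 \<inter> C2.
        C1 \<noteq> C2 \<and> c < Max (sym_diff C1 C2) \<longrightarrow>
        (\<exists>C3\<in>circuits E \<Delta>. C3 \<subseteq> (C1 \<union> C2) - {c}))"

definition broken_circuits :: "'a::linorder set \<Rightarrow> 'a set set \<Rightarrow> 'a set set" where
  "broken_circuits E \<Delta> = {C - {Min C} |C. C \<in> circuits E \<Delta>}"

text \<open>The set of faces of the nbc complex. If every basis contains a broken circuit, this
  is the void complex, which has no faces at all (not even the empty one).\<close>

definition nbc :: "'a::linorder set \<Rightarrow> 'a set set \<Rightarrow> 'a set set" where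
  "nbc E \<Delta> = {A. \<exists>B\<in>bases \<Delta>. (\<forall>D\<in>broken_circuits E \<Delta>. \<not> D \<subseteq> B) \<and> A \<subseteq> B}"

definition shelling_order :: "'a set set \<Rightarrow> 'a set list \<Rightarrow> bool" where
  "shelling_order \<Delta> Bs \<longleftrightarrow> pure \<Delta> \<and> distinct Bs \<and> set Bs = bases \<Delta> \<and>
     (\<forall>j<length Bs. \<forall>i<j. \<exists>l<j. \<exists>b\<in>Bs ! j.
        Bs ! i \<inter> Bs ! j \<subseteq> Bs ! l \<inter> Bs ! j \<and> Bs ! l \<inter> Bs ! j = Bs ! j - {b})"

text \<open>The list of all bases in lexicographic order: the outer \<^const>\<open>sorted_list_of_set\<close>
  sorts by the dictionary order on lists, the inner one turns each basis into its
  increasing list of elements. \<open>set_lex_bases\<close> and \<open>sorted_lex_bases\<close> confirm the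
  reading for finite complexes.\<close>

definition lex_bases :: "'a::linorder set set \<Rightarrow> 'a set list" where
  "lex_bases \<Delta> = map set (sorted_list_of_set (sorted_list_of_set ` bases \<Delta>))"

lemma finite_bases:
  assumes "finite E" "\<Delta> \<subseteq> Pow E"
  shows "finite (bases \<Delta>)" and "\<And>B. B \<in> bases \<Delta> \<Longrightarrow> finite B"
proof -
  have "bases \<Delta> \<subseteq> Pow E" using assms(2) by (auto simp: bases_def)
  then show "finite (bases \<Delta>)" and "\<And>B. B \<in> bases \<Delta> \<Longrightarrow> finite B"
    using assms(1) by (auto intro: finite_subset)
qed

lemma set_lex_bases:
  assumes "finite E" "\<Delta> \<subseteq> Pow E"
  shows "set (lex_bases \<Delta>) = bases \<Delta>"
  using finite_bases[OF assms] by (force simp: lex_bases_def image_image)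

lemma sorted_lex_bases:
  assumes "finite E" "\<Delta> \<subseteq> Pow E"
  shows "sorted_wrt (\<lambda>A B. sorted_list_of_set A < sorted_list_of_set B) (lex_bases \<Delta>)"
proof -
  let ?L = "sorted_list_of_set (sorted_list_of_set ` bases \<Delta>)"
  have *: "sorted_list_of_set (set xs) = xs" if "xs \<in> set ?L" for xs
    using that finite_bases[OF assms] by auto
  have "sorted_wrt (<) ?L" by (rule strict_sorted_list_of_set)
  then have "sorted_wrt (\<lambda>xs ys. sorted_list_of_set (set xs) < sorted_list_of_set (set ys)) ?L"
    by (rule sorted_wrt_mono_rel[rotated]) (simp only: *)
  then show ?thesis by (simp add: lex_bases_def sorted_wrt_map)
qed

end

(* Lexicographic comparison by exchanges.  If A precedes B among the bases, then QE at the largest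
   element m of the symmetric difference either exchanges m (in B) for a smaller element of A, or
   (m in A) replaces A by a lexicographically smaller basis closer to B.  Hence some b in B - A can
   be exchanged for a smaller element of E.  If B is an nbc basis and a is the least element that can
   replace b, then B - b + a is again nbc: for a broken circuit C - c inside it, eliminating c
   between C and the circuit in B - b + c would give a circuit inside B - b + a. *)
theory Submission
  imports Defs
begin

text \<open>Both lists agree up to the place where \<open>a\<close> goes in. There the second list
  has either \<open>b\<close> or an element of \<open>xs\<close> exceeding \<open>a\<close>.\<close>

lemma insort_less_insort:
  fixes a b :: "'a::linorder"
  assumes "a < b" "a \<notin> set xs"
  shows "insort a xs < insort b xs"
  using assms by (induction xs) auto

lemma lex_less_exchange:
  fixes B :: "'a::linorder set"
  assumes "finite B" "b \<in> B" "a \<notin> B" "a < b"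
  shows "sorted_list_of_set (insert a (B - {b})) < sorted_list_of_set B"
proof -
  have "sorted_list_of_set (insert b (B - {b})) = insort b (sorted_list_of_set (B - {b}))"
    using assms(1) by (intro sorted_list_of_set.fold_insort_key.insert) auto
  moreover have "sorted_list_of_set (insert a (B - {b})) = insort a (sorted_list_of_set (B - {b}))"
    using assms(1,3) by (intro sorted_list_of_set.fold_insort_key.insert) auto
  ultimately show ?thesis
    using insort_less_insort[of a b "sorted_list_of_set (B - {b})"] assms
    by (simp add: insert_absorb)
qed

lemma card_exchange:
  assumes "finite B" "b \<in> B" "a \<notin> B"
  shows "card (insert a (B - {b})) = card B"
proof -
  have "card (insert a (B - {b})) = Suc (card (B - {b}))" using assms by simp
  then show ?thesis using card_Suc_Diff1[OF assms(1,2)] by simp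
qed

text \<open>A maximal face containing \<open>X\<close> is a basis, so by purity it has the size of
  \<open>B\<close>, which is that of \<open>X\<close>; hence it equals \<open>X\<close>.\<close>

lemma basis_of_card_eq:
  assumes "finite E" "\<Delta> \<subseteq> Pow E" "pure \<Delta>" "B \<in> bases \<Delta>" "X \<in> \<Delta>" "card X = card B"
  shows "X \<in> bases \<Delta>"
proof -
  have "finite \<Delta>" using assms(1,2) by (meson finite_Pow_iff finite_subset)
  then obtain Y where Y: "Y \<in> \<Delta>" "X \<subseteq> Y" "\<forall>Z\<in>\<Delta>. Y \<subseteq> Z \<longrightarrow> Y = Z"
    using finite_has_maximal2[of \<Delta> X] assms(5) by auto
  then have "Y \<in> bases \<Delta>" by (auto simp: bases_def)
  moreover from this have "finite Y" using finite_bases(2)[OF assms(1,2)] by blast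
  moreover have "card Y = card B" using \<open>Y \<in> bases \<Delta>\<close> assms(3,4) unfolding pure_def by blast
  ultimately show ?thesis using card_subset_eq[of Y X] Y(2) assms(6) by simp
qed

lemma exchange_mem_bases:
  assumes "finite E" "\<Delta> \<subseteq> Pow E" "pure \<Delta>" "B \<in> bases \<Delta>" "b \<in> B" "a \<notin> B"
    and "insert a (B - {b}) \<in> \<Delta>"
  shows "insert a (B - {b}) \<in> bases \<Delta>"
proof -
  have "finite B" using finite_bases(2)[OF assms(1,2,4)] .
  then have "card (insert a (B - {b})) = card B" using assms(5,6) by (rule card_exchange)
  then show ?thesis by (rule basis_of_card_eq[OF assms(1-4,7)])
qed

lemma circuit_subset:
  assumes "finite X" "X \<subseteq> E" "X \<notin> \<Delta>"
  obtains C where "C \<in> circuits E \<Delta>" "C \<subseteq> X"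
proof -
  let ?S = "{D. D \<subseteq> X \<and> D \<notin> \<Delta>}"
  have "finite ?S" "X \<in> ?S" using assms by auto
  then obtain C where C: "C \<in> ?S" "\<forall>D\<in>?S. D \<subseteq> C \<longrightarrow> C = D"
    using finite_has_minimal2[of ?S X] by auto
  then have "C \<in> circuits E \<Delta>" using assms(2) by (auto simp: circuits_def)
  with C(1) that show thesis by auto
qed

text \<open>Taking \<open>b\<close> outside \<open>A\<close> is what the shelling needs: removing
  \<open>b\<close> from \<open>B\<close> keeps all of the intersection of \<open>A\<close> and
  \<open>B\<close>.\<close>

lemma QE_smaller_exchange:
  fixes E :: "'a::linorder set"
  assumes "finite E" "\<Delta> \<subseteq> Pow E" "QE \<Delta>"
    and "A \<in> bases \<Delta>" "B \<in> bases \<Delta>" "sorted_list_of_set A < sorted_list_of_set B"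
  shows "\<exists>b\<in>B - A. \<exists>a. a \<notin> B \<and> a < b \<and> insert a (B - {b}) \<in> \<Delta>"
  using assms(4,6)
proof (induction "card (A - B)" arbitrary: A rule: less_induct)
  case less
  note fin = finite_bases(2)[OF assms(1,2)]
  have exch: "\<exists>b2\<in>B2 - B1. insert b2 (B1 - {b1}) \<in> \<Delta>"
    if "B1 \<in> bases \<Delta>" "B2 \<in> bases \<Delta>" "b1 \<in> B1 - B2" "Max (B2 - B1) < b1" for B1 B2 b1
    using assms(3) that by (auto simp: QE_def)
  have pure: "pure \<Delta>" using assms(3) by (simp add: QE_def)
  have finA: "finite A" and finB: "finite B" using fin less.prems(1) assms(5) by auto
  have "A \<noteq> B" using less.prems(2) by auto
  then have ne: "A - B \<noteq> {}" "B - A \<noteq> {}"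
    using less.prems(1) assms(5) by (auto simp: bases_def)
  then have mA: "Max (A - B) \<in> A - B" and mB: "Max (B - A) \<in> B - A"
    using finA finB by (auto intro!: Max_in simp del: Diff_iff)
  show ?case
  proof (cases "Max (A - B) < Max (B - A)")
    \<comment> \<open>The top of the symmetric difference lies in \<open>B\<close>: whatever element
      of \<open>A - B\<close> QE supplies is automatically smaller.\<close>
    case True
    then obtain a where a: "a \<in> A - B" "insert a (B - {Max (B - A)}) \<in> \<Delta>"
      using exch[OF assms(5) less.prems(1) mB] by blast
    then have "a \<le> Max (A - B)" using finA by simp
    with a True mB show ?thesis by (meson DiffD2 le_less_trans)
  next
    \<comment> \<open>Now the top lies in \<open>A\<close>, so QE can only be applied with the roles
      of \<open>A\<close> and \<open>B\<close> reversed. It yields a new basis that trades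
      \<open>m\<close> for an element of \<open>B\<close>.\<close>
    case False
    define m where "m = Max (A - B)"
    have "Max (B - A) < m" using False mA mB by (metis DiffD1 DiffD2 linorder_neqE m_def)
    then obtain a where a: "a \<in> B - A" "insert a (A - {m}) \<in> \<Delta>"
      using exch[OF less.prems(1) assms(5)] mA unfolding m_def by blast
    have "a \<le> Max (B - A)" using a finB by simp
    then have "a < m" using \<open>Max (B - A) < m\<close> by simp
    define A' where "A' = insert a (A - {m})"
    have "A' \<in> bases \<Delta>"
      using exchange_mem_bases[OF assms(1,2) pure less.prems(1)] a mA by (simp add: A'_def m_def)
    moreover have "sorted_list_of_set A' < sorted_list_of_set A"
      unfolding A'_def using lex_less_exchange[OF finA] a mA \<open>a < m\<close> by (simp add: m_def)
    then have "sorted_list_of_set A' < sorted_list_of_set B" using less.prems(2) by simp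
    moreover have "A' - B \<subset> A - B" using a mA by (auto simp: A'_def m_def)
    then have "card (A' - B) < card (A - B)" using finA by (simp add: psubset_card_mono)
    ultimately obtain b c where "b \<in> B - A'" "c \<notin> B" "c < b" "insert c (B - {b}) \<in> \<Delta>"
      using less.hyps[of A'] by blast
    \<comment> \<open>\<open>A'\<close> lost only \<open>m\<close> from \<open>A\<close>, and
      \<open>m\<close> is outside \<open>B\<close>, so \<open>B - A'\<close> is contained in
      \<open>B - A\<close> and the \<open>b\<close> found for \<open>A'\<close> also serves
      \<open>A\<close>.\<close>
    moreover have "m \<notin> B" using mA by (simp add: m_def)
    ultimately show ?thesis unfolding A'_def by blast
  qed
qed

definition nbc_bases :: "'a::linorder set \<Rightarrow> 'a set set \<Rightarrow> 'a set set" where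
  "nbc_bases E \<Delta> = {B \<in> bases \<Delta>. \<forall>D\<in>broken_circuits E \<Delta>. \<not> D \<subseteq> B}"

text \<open>Every face of \<open>nbc E \<Delta>\<close> lies in one of the generating bases, and
  distinct bases of \<open>\<Delta>\<close> are never nested, so the generators are exactly the
  maximal faces. With no generators both sides are empty.\<close>

lemma bases_nbc: "bases (nbc E \<Delta>) = nbc_bases E \<Delta>"
proof
  show "bases (nbc E \<Delta>) \<subseteq> nbc_bases E \<Delta>"
  proof
    fix B assume B: "B \<in> bases (nbc E \<Delta>)"
    then have "B \<in> nbc E \<Delta>" by (simp add: bases_def)
    then obtain B' where B': "B' \<in> nbc_bases E \<Delta>" "B \<subseteq> B'"
      unfolding nbc_def nbc_bases_def by blast
    then have "B' \<in> nbc E \<Delta>" unfolding nbc_def nbc_bases_def by blast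
    then have "B' = B" using B B'(2) by (simp add: bases_def)
    with B' show "B \<in> nbc_bases E \<Delta>" by simp
  qed
next
  show "nbc_bases E \<Delta> \<subseteq> bases (nbc E \<Delta>)"
  proof
    fix B assume B: "B \<in> nbc_bases E \<Delta>"
    then have "B \<in> nbc E \<Delta>" unfolding nbc_def nbc_bases_def by blast
    moreover have "A = B" if A: "A \<in> nbc E \<Delta>" "B \<subseteq> A" for A
    proof -
      obtain B' where "B' \<in> bases \<Delta>" "A \<subseteq> B'" using A(1) unfolding nbc_def by blast
      then have "B' = B" using B A(2) by (simp add: nbc_bases_def bases_def)
      then show "A = B" using \<open>A \<subseteq> B'\<close> A(2) by simp
    qed
    ultimately show "B \<in> bases (nbc E \<Delta>)" by (simp add: bases_def)
  qed
qed

text \<open>The removed element \<open>b\<close> stays fixed while the new one may change: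
  \<open>a'\<close> matters only through \<open>a' < b\<close>, which puts the new basis before
  \<open>B\<close>.\<close>

lemma QC_nbc_exchange:
  fixes E :: "'a::linorder set"
  assumes complex: "ordered_simplicial_complex E \<Delta>" and "pure \<Delta>" "QC E \<Delta>"
    and B: "B \<in> nbc_bases E \<Delta>" "b \<in> B"
    and a: "a \<notin> B" "a < b" "insert a (B - {b}) \<in> \<Delta>"
  obtains a' where "a' \<notin> B" "a' < b" "insert a' (B - {b}) \<in> nbc_bases E \<Delta>"
proof -
  have E: "finite E" "\<Delta> \<subseteq> Pow E" and down: "\<And>X Y. X \<in> \<Delta> \<Longrightarrow> Y \<subseteq> X \<Longrightarrow> Y \<in> \<Delta>"
    using complex unfolding ordered_simplicial_complex_def by simp_all
  have basis: "B \<in> bases \<Delta>" and free: "\<And>D. D \<in> broken_circuits E \<Delta> \<Longrightarrow> \<not> D \<subseteq> B"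
    using B(1) by (auto simp: nbc_bases_def)
  have BE: "B \<in> \<Delta>" "B \<subseteq> E" using basis E by (auto simp: bases_def)
  let ?S = "{x. x \<notin> B \<and> x < b \<and> insert x (B - {b}) \<in> \<Delta>}"
  have "?S \<subseteq> E" using E(2) by auto
  then have fin: "finite ?S" using E(1) finite_subset by blast
  \<comment> \<open>By minimality, every element below \<open>m\<close> and outside \<open>B\<close>
    gives a dependent set when it replaces \<open>b\<close>; this is the source of the second
    circuit \<open>C2\<close>.\<close>
  define m where "m = Min ?S"
  have "m \<in> ?S" unfolding m_def using fin a by (intro Min_in) auto
  then have m: "m \<notin> B" "m < b" and mem: "insert m (B - {b}) \<in> \<Delta>" by auto
  have least: "m \<le> x" if "x \<notin> B" "x < b" "insert x (B - {b}) \<in> \<Delta>" for x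
    unfolding m_def using fin that by (intro Min_le) auto
  have "\<not> D \<subseteq> insert m (B - {b})" if D: "D \<in> broken_circuits E \<Delta>" for D
  proof
    assume sub: "D \<subseteq> insert m (B - {b})"
    obtain C where C: "C \<in> circuits E \<Delta>" and DC: "D = C - {Min C}"
      using D by (auto simp: broken_circuits_def)
    have CE: "C \<subseteq> E" "C \<notin> \<Delta>" using C by (auto simp: circuits_def)
    define c where "c = Min C"
    \<comment> \<open>\<open>B\<close> contains no broken circuit, so \<open>D\<close> must use the
      one new element.\<close>
    have "m \<in> D" using free[OF D] sub by blast
    then have "m \<in> C" "m \<noteq> c" by (auto simp: DC c_def)
    have "finite C" using CE E(1) finite_subset by blast
    then have "c \<in> C" unfolding c_def using \<open>m \<in> C\<close> by (intro Min_in) auto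
    have "c \<le> m" unfolding c_def using \<open>finite C\<close> \<open>m \<in> C\<close> by (rule Min_le)
    then have "c < m" using \<open>m \<noteq> c\<close> by simp
    have C_sub: "C - {c} \<subseteq> insert m (B - {b})" using sub by (simp add: DC c_def)
    have "c \<notin> B"
    proof
      assume "c \<in> B"
      \<comment> \<open>Since \<open>c < m < b\<close>, the element \<open>c\<close> differs from
        \<open>b\<close> and survives its removal.\<close>
      then have "C \<subseteq> insert m (B - {b})" using C_sub \<open>c < m\<close> m(2) by auto
      then show False using down[OF mem] CE(2) by blast
    qed
    then have "insert c (B - {b}) \<notin> \<Delta>" using least[of c] \<open>c < m\<close> m(2) by force
    moreover have "insert c (B - {b}) \<subseteq> E" using \<open>c \<in> C\<close> CE BE by auto
    ultimately obtain C2 where C2: "C2 \<in> circuits E \<Delta>" "C2 \<subseteq> insert c (B - {b})"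
      using circuit_subset finite_subset[OF _ E(1)] by metis
    have "c \<in> C2"
    proof (rule ccontr)
      assume "c \<notin> C2"
      then have "C2 \<subseteq> B" using C2(2) by auto
      then show False using down[OF BE(1)] C2(1) by (auto simp: circuits_def)
    qed
    \<comment> \<open>Thus \<open>m\<close> is in \<open>C\<close> but not in \<open>C2\<close> and
      exceeds \<open>c\<close>, which gives both \<open>C \<noteq> C2\<close> and the order
      condition of QC.\<close>
    have "m \<notin> C2" using C2(2) m(1) \<open>c < m\<close> by auto
    have "finite (sym_diff C C2)"
      using \<open>finite C\<close> C2(1) E(1) finite_subset[of C2 E] by (auto simp: circuits_def)
    then have "m \<le> Max (sym_diff C C2)" using \<open>m \<in> C\<close> \<open>m \<notin> C2\<close> by (intro Max_ge) auto
    then have "c < Max (sym_diff C C2)" using \<open>c < m\<close> by simp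
    then obtain C3 where C3: "C3 \<in> circuits E \<Delta>" "C3 \<subseteq> (C \<union> C2) - {c}"
      using assms(3)[unfolded QC_def, rule_format, OF C C2(1), of c] \<open>c \<in> C\<close> \<open>c \<in> C2\<close>
        \<open>m \<in> C\<close> \<open>m \<notin> C2\<close> by blast
    \<comment> \<open>Apart from \<open>c\<close>, both circuits lie in this face, so a circuit
      avoiding \<open>c\<close> in their union would be a face.\<close>
    then have "C3 \<subseteq> insert m (B - {b})" using C_sub C2(2) by auto
    then show False using down[OF mem] C3(1) by (auto simp: circuits_def)
  qed
  moreover have "insert m (B - {b}) \<in> bases \<Delta>"
    using exchange_mem_bases[OF E assms(2) basis B(2) m(1) mem] .
  ultimately show thesis using that[of m] m by (simp add: nbc_bases_def)
qed

theorem theorem6p4: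
  fixes E :: "'a::linorder set" and \<Delta> :: "'a set set"
  assumes "ordered_simplicial_complex E \<Delta>"
    and "QE \<Delta>"
    and "QC E \<Delta>"
  shows "shelling_order (nbc E \<Delta>) (lex_bases (nbc E \<Delta>))"
proof -
  have E: "finite E" "\<Delta> \<subseteq> Pow E" using assms(1) by (simp_all add: ordered_simplicial_complex_def)
  have pure: "pure \<Delta>" using assms(2) by (simp add: QE_def)
  have nbcE: "nbc E \<Delta> \<subseteq> Pow E" using E(2) unfolding nbc_def bases_def by blast
  define Bs where "Bs = lex_bases (nbc E \<Delta>)"
  have set_Bs: "set Bs = nbc_bases E \<Delta>"
    unfolding Bs_def using set_lex_bases[OF E(1) nbcE] by (simp add: bases_nbc)
  have less: "sorted_list_of_set (Bs ! i) < sorted_list_of_set (Bs ! j)"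
    if "i < j" "j < length Bs" for i j
    using sorted_wrt_nth_less[OF sorted_lex_bases[OF E(1) nbcE]] that by (simp add: Bs_def)
  have "distinct Bs"
    unfolding distinct_conv_nth by (metis less linorder_neqE_nat order_less_irrefl)
  moreover have "pure (nbc E \<Delta>)" using pure unfolding pure_def bases_nbc nbc_bases_def by blast
  moreover have "\<exists>l<j. \<exists>b\<in>Bs ! j.
      Bs ! i \<inter> Bs ! j \<subseteq> Bs ! l \<inter> Bs ! j \<and> Bs ! l \<inter> Bs ! j = Bs ! j - {b}"
    if ij: "j < length Bs" "i < j" for i j
  proof -
    have nbcs: "Bs ! i \<in> nbc_bases E \<Delta>" "Bs ! j \<in> nbc_bases E \<Delta>"
      using that by (auto simp flip: set_Bs)
    then have bas: "Bs ! i \<in> bases \<Delta>" "Bs ! j \<in> bases \<Delta>" by (auto simp: nbc_bases_def)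
    obtain b a where b: "b \<in> Bs ! j - Bs ! i"
      and a: "a \<notin> Bs ! j" "a < b" "insert a (Bs ! j - {b}) \<in> \<Delta>"
      using QE_smaller_exchange[OF E assms(2) bas less[OF ij(2,1)]] by blast
    obtain a' where a': "a' \<notin> Bs ! j" "a' < b" "insert a' (Bs ! j - {b}) \<in> nbc_bases E \<Delta>"
      using QC_nbc_exchange[OF assms(1) pure assms(3) nbcs(2) _ a] b by blast
    then obtain l where l: "l < length Bs" "Bs ! l = insert a' (Bs ! j - {b})"
      by (metis set_Bs in_set_conv_nth)
    have "sorted_list_of_set (Bs ! l) < sorted_list_of_set (Bs ! j)"
      unfolding l(2) using lex_less_exchange[OF finite_bases(2)[OF E bas(2)]] a' b by simp
    \<comment> \<open>\<open>l\<close> came only from membership in the list; since the list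
      increases lexicographically, comparing the bases recovers its position.\<close>
    then have "l < j" using less[of j l] l(1)
      by (metis linorder_neqE_nat order_less_asym order_less_irrefl)
    moreover have "Bs ! l \<inter> Bs ! j = Bs ! j - {b}" using l(2) a'(1) by auto
    moreover have "Bs ! i \<inter> Bs ! j \<subseteq> Bs ! j - {b}" using b by auto
    ultimately show ?thesis using b by (metis DiffD1)
  qed
  ultimately show ?thesis using set_Bs by (simp add: shelling_order_def bases_nbc flip: Bs_def)
qed

end
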